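(* Let $N\ge 1$ be an integer and consider the caching problem with $N$ files and $K=N$ users, each equipped with a cache of the same (normalized) size $M$, where $0\le M\le 1/N$. Then the rate $R(M)=N(1-M)$ is achievable with cache size $M$ (i.e. the pair $(M,N(1-M))$ is achievable) and it coincides with the cut-set bound: $$N(1-M)=\max_{s\in\{1,\dots,\min(N,K)\}}\left(s-\frac{s}{\lfloor N/s\rfloor}M\right).$$
   Context: Caching problem with $N$ files and $K$ users. A server holds $N$ independent files $W_1,\dots,W_N$, each uniformly distributed on $\{0,1\}^F$ ($F$ bits per file). All $K$ users are connected to the server through one shared error-free link, so that every user receives everything the server transmits. Each user has a cache. The system works in two phases. Placement phase (before demands are known): user $k$ stores in its cache $Z_k=\varphi_k(W_1,\dots,W_N)$, where $\varphi_k$ is an arbitrary function. Delivery phase: each user $k$ requests one full file $W_{d_k}$; the demand vector $d=(d_1,\dots,d_K)\in\{1,\dots,N\}^K$ is arbitrary and known to the server and all users. The server broadcasts $X_d=\psi_d(W_1,\dots,W_N)$, and user $k$ forms an estimate $\hat W_{d,k}=\mu_{d,k}(X_d,Z_k)$ of $W_{d_k}$. The functions $\varphi_k,\psi_d,\mu_{d,k}$ form a caching scheme for file size $F$; its error probability is $\max_{d}\max_{k}\Pr(\hat W_{d,k}\neq W_{d_k})$. Cache sizes and rates are normalized by the file size. A cache-rate pair $(M,R)$ with $M,R\ge 0$ is called achievable if for every $\varepsilon>0$ and all sufficiently large $F$ there is a caching scheme for file size $F$ in which each $Z_k$ takes at most $2^{(M+\varepsilon)F}$ values, each $X_d$ (for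 every demand $d$) takes at most $2^{(R+\varepsilon)F}$ values, and the error probability is less than $\varepsilon$. The rate $R$ is thus a peak (worst-case over demands) rate. Cut-set bound (known from the earlier literature, Maddah-Ali and Niesen): every achievable pair $(M,R)$ satisfies $R\ge \max_{s\in\{1,\dots,\min(N,K)\}}\left(s-\frac{s}{\lfloor N/s\rfloor}M\right)$; the right-hand side is called the cut-set bound. *)

theory Defs
  imports "HOL-Probability.Probability"
begin

(* Files and users are indexed from 1; a file is a list of F bits. *)
type_synonym bits = "bool list"
type_synonym demand = "nat \<Rightarrow> nat"

(* N independent uniform files; undefined is the value outside the index set {1..N}. *)
definition files_pmf :: "nat \<Rightarrow> nat \<Rightarrow> (nat \<Rightarrow> bits) pmf" where
  "files_pmf N F = Pi_pmf {1..N} undefined (\<lambda>_. pmf_of_set {w. length w = F})"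

definition demands :: "nat \<Rightarrow> nat \<Rightarrow> demand set" where
  "demands N K = {1..K} \<rightarrow>\<^sub>E {1..N}"

(* Cache contents and transmitted messages are natural numbers. This is no restriction:
   for fixed F they take finitely many values, and only the number of values matters.
   The decoder takes the demand vector, the user, the message received and the cache. *)
record caching_scheme =
  placement :: "nat \<Rightarrow> (nat \<Rightarrow> bits) \<Rightarrow> nat"
  delivery :: "demand \<Rightarrow> (nat \<Rightarrow> bits) \<Rightarrow> nat"
  decoder :: "demand \<Rightarrow> nat \<Rightarrow> nat \<Rightarrow> nat \<Rightarrow> bits"

definition estimate :: "caching_scheme \<Rightarrow> demand \<Rightarrow> nat \<Rightarrow> (nat \<Rightarrow> bits) \<Rightarrow> bits" where
  "estimate S d k W = decoder S d k (delivery S d W) (placement S k W)"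

(* Meaningful for N, K > 0; otherwise one of the maxima is over the empty set. *)
definition error_probability :: "nat \<Rightarrow> nat \<Rightarrow> nat \<Rightarrow> caching_scheme \<Rightarrow> real" where
  "error_probability N K F S =
     (MAX d\<in>demands N K. MAX k\<in>{1..K}.
        measure_pmf.prob (files_pmf N F) {W. estimate S d k W \<noteq> W (d k)})"

definition num_values :: "nat \<Rightarrow> nat \<Rightarrow> ((nat \<Rightarrow> bits) \<Rightarrow> nat) \<Rightarrow> nat" where
  "num_values N F f = card (f ` set_pmf (files_pmf N F))"

definition achievable :: "nat \<Rightarrow> nat \<Rightarrow> real \<Rightarrow> real \<Rightarrow> bool" where
  "achievable N K M R \<longleftrightarrow> M \<ge> 0 \<and> R \<ge> 0 \<and>
     (\<forall>\<epsilon>>0. \<forall>\<^sub>F F in sequentially. \<exists>S.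
        (\<forall>k\<in>{1..K}. real (num_values N F (placement S k)) \<le> 2 powr ((M + \<epsilon>) * real F)) \<and>
        (\<forall>d\<in>demands N K. real (num_values N F (delivery S d)) \<le> 2 powr ((R + \<epsilon>) * real F)) \<and>
        error_probability N K F S < \<epsilon>)"

definition cut_set_bound :: "nat \<Rightarrow> nat \<Rightarrow> real \<Rightarrow> real" where
  "cut_set_bound N K M =
     (MAX s\<in>{1..min N K}. real s - real s / real_of_int \<lfloor>real N / real s\<rfloor> * M)"

end

theory Submission
  imports Defs
begin

text \<open>
  Memory sharing with \<open>L = \<lfloor>M F\<rfloor>\<close>: the first \<open>N L\<close> bits of each file form \<open>N\<close> blocks of
  \<open>L\<close> bits, and user \<open>k\<close> caches the exclusive or over all files of their \<open>k\<close>-th blocks.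
  If the demands are pairwise distinct, the server transmits everything except the \<open>j\<close>-th block
  of file \<open>d j\<close> for each user \<open>j\<close>. The only bits of its file that user \<open>k\<close> does not receive are
  then those of block \<open>k\<close>, and these follow from its cache, since the \<open>k\<close>-th blocks of all other
  files are transmitted. This takes \<open>N F - N L\<close> bits. If some demands coincide, the at most
  \<open>N - 1\<close> requested files are transmitted outright, which is no longer since \<open>N L \<le> F\<close>.
\<close>

section \<open>Zero-error schemes from finite families of sets\<close>

lemma set_pmf_files_pmf:
  assumes "W \<in> set_pmf (files_pmf N F)" and "n \<in> {1..N}"
  shows "length (W n) = F"
proof -
  have fin: "finite {w :: bits. length w = F}"
    using finite_lists_length_eq[of "UNIV :: bool set" F] by simp
  moreover have "replicate F True \<in> {w :: bits. length w = F}" by simp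
  ultimately have "set_pmf (pmf_of_set {w :: bits. length w = F}) = {w. length w = F}"
    by (metis empty_iff set_pmf_of_set)
  with assms show ?thesis
    by (auto simp: files_pmf_def set_Pi_pmf PiE_dflt_def)
qed

lemma num_values_le:
  assumes "finite A" and "\<And>W. g W \<subseteq> A"
  shows "num_values N F (\<lambda>W. to_nat_on (Pow A) (g W)) \<le> 2 ^ card A"
proof -
  have "num_values N F (\<lambda>W. to_nat_on (Pow A) (g W)) \<le> card (to_nat_on (Pow A) ` Pow A)"
    unfolding num_values_def using assms by (intro card_mono) auto
  also have "\<dots> \<le> card (Pow A)"
    using assms by (intro card_image_le) auto
  finally show ?thesis by (simp add: card_Pow assms)
qed

lemma error_probability_eq_0:
  assumes "N \<ge> 1" and "K \<ge> 1"
    and "\<And>d k W. d \<in> demands N K \<Longrightarrow> k \<in> {1..K} \<Longrightarrow> W \<in> set_pmf (files_pmf N F) \<Longrightarrow>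
           estimate S d k W = W (d k)"
  shows "error_probability N K F S = 0"
proof -
  have "measure_pmf.prob (files_pmf N F) {W. estimate S d k W \<noteq> W (d k)} = 0"
    if "d \<in> demands N K" "k \<in> {1..K}" for d k
    using assms(3)[OF that] by (auto simp: measure_pmf_zero_iff)
  then have "error_probability N K F S = (MAX d\<in>demands N K. MAX k\<in>{1..K}. 0)"
    unfolding error_probability_def by (intro arg_cong[where f = Max] image_cong refl) auto
  moreover have "demands N K \<noteq> {}"
    using assms(1) by (auto simp: demands_def PiE_eq_empty_iff)
  moreover have "finite (demands N K)" by (simp add: demands_def finite_PiE)
  ultimately show ?thesis using assms(2) by simp
qed

text \<open>Subsets of \<open>A\<close> and \<open>B d\<close> stand for bit strings of length \<open>card A\<close> and \<open>card (B d)\<close>.\<close>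

lemma zero_error_scheme:
  assumes "N \<ge> 1" and "K \<ge> 1"
    and A: "finite A" "\<And>k W. Z k W \<subseteq> A"
    and B: "\<And>d. finite (B d)" "\<And>d W. X d W \<subseteq> B d"
    and determined: "\<And>d k W W'. d \<in> demands N K \<Longrightarrow> k \<in> {1..K} \<Longrightarrow>
       W \<in> set_pmf (files_pmf N F) \<Longrightarrow> W' \<in> set_pmf (files_pmf N F) \<Longrightarrow>
       Z k W = Z k W' \<Longrightarrow> X d W = X d W' \<Longrightarrow> W (d k) = W' (d k)"
  shows "\<exists>S. (\<forall>k. num_values N F (placement S k) \<le> 2 ^ card A) \<and>
             (\<forall>d. num_values N F (delivery S d) \<le> 2 ^ card (B d)) \<and>
             error_probability N K F S = 0"
proof -
  define z where "z k W = to_nat_on (Pow A) (Z k W)" for k W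
  define x where "x d W = to_nat_on (Pow (B d)) (X d W)" for d W
  \<comment> \<open>The decoder picks any file tuple in the support that explains the message and
    the cache; by \<open>determined\<close>, all such tuples agree on the requested file.\<close>
  define consistent where "consistent d b k c W \<longleftrightarrow>
    W \<in> set_pmf (files_pmf N F) \<and> x d W = b \<and> z k W = c" for d b k c W
  define S where "S = \<lparr>placement = z, delivery = x,
    decoder = \<lambda>d k b c. (SOME W. consistent d b k c W) (d k)\<rparr>"
  have "estimate S d k W = W (d k)"
    if d: "d \<in> demands N K" and k: "k \<in> {1..K}" and W: "W \<in> set_pmf (files_pmf N F)" for d k W
  proof -
    define W' where "W' = (SOME W'. consistent d (x d W) k (z k W) W')"
    have "consistent d (x d W) k (z k W) W'"
      unfolding W'_def by (rule someI[of _ W]) (simp add: consistent_def W)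
    then have W': "W' \<in> set_pmf (files_pmf N F)" and "x d W' = x d W" "z k W' = z k W"
      by (auto simp: consistent_def)
    \<comment> \<open>\<open>to_nat_on\<close> is injective on the finite power sets, so equal codes
      come from equal sets.\<close>
    then have "X d W' = X d W" "Z k W' = Z k W"
      using A B by (simp_all add: x_def z_def countable_finite)
    with determined[OF d k W' W] have "W' (d k) = W (d k)" by simp
    then show ?thesis by (simp add: estimate_def S_def W'_def)
  qed
  then have "error_probability N K F S = 0"
    using error_probability_eq_0[OF assms(1,2)] by blast
  moreover have "num_values N F (placement S k) \<le> 2 ^ card A" for k
    using num_values_le[of A "Z k"] A by (simp add: S_def z_def[abs_def])
  moreover have "num_values N F (delivery S d) \<le> 2 ^ card (B d)" for d
    using num_values_le[of "B d" "X d"] B by (simp add: S_def x_def[abs_def])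
  ultimately show ?thesis by blast
qed

section \<open>Coded placement and delivery\<close>

text \<open>Cancellation of known terms in an exclusive or: away from \<open>a\<close> both sets
  have the same members, and adding \<open>a\<close> flips the parity.\<close>

lemma eq_if_parity_eq:
  assumes "finite A" and "a \<in> A" and "\<And>n. n \<in> A - {a} \<Longrightarrow> P n = Q n"
    and "odd (card {n \<in> A. P n}) = odd (card {n \<in> A. Q n})"
  shows "P a = Q a"
proof -
  define C where "C = {n \<in> A - {a}. P n}"
  have C: "finite C" "a \<notin> C" using assms(1) by (auto simp: C_def)
  have "{n \<in> A. P n} = (if P a then insert a C else C)"
    "{n \<in> A. Q n} = (if Q a then insert a C else C)"
    using assms(2,3) by (auto simp: C_def)
  with assms(4) C show ?thesis by (auto split: if_splits)
qed

text \<open>The pair \<open>(n, p)\<close> addresses bit \<open>p\<close> of file \<open>n\<close>,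
  and \<open>p div L + 1\<close> is the user whose block contains position \<open>p\<close>. For
  \<open>L = 0\<close> nothing is removed.\<close>

definition transmitted :: "nat \<Rightarrow> nat \<Rightarrow> nat \<Rightarrow> demand \<Rightarrow> (nat \<times> nat) set" where
  "transmitted N F L d =
     (if inj_on d {1..N}
      then {1..N} \<times> {..<F} - (\<lambda>p. (d (p div L + 1), p)) ` {..<N * L}
      else (d ` {1..N}) \<times> {..<F})"

lemma finite_transmitted: "finite (transmitted N F L d)"
  by (simp add: transmitted_def)

lemma block_user: "p div L + 1 \<in> {1..N}" if "p < N * L" for p L N :: nat
  using that by (simp add: less_mult_imp_div_less Suc_leI)

lemma card_transmitted:
  assumes d: "d \<in> demands N N" and "N * L \<le> F"
  shows "card (transmitted N F L d) \<le> N * (F - L)"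
proof (cases "inj_on d {1..N}")
  case True
  let ?h = "\<lambda>p. (d (p div L + 1), p)"
  \<comment> \<open>The second component alone makes \<open>?h\<close> injective, so exactly
    \<open>N * L\<close> bits are saved.\<close>
  have "card (?h ` {..<N * L}) = N * L"
    by (subst card_image) (auto simp: inj_on_def)
  moreover have "?h ` {..<N * L} \<subseteq> {1..N} \<times> {..<F}"
  proof (rule image_subsetI)
    fix p assume p: "p \<in> {..<N * L}"
    then have "p div L + 1 \<in> {1..N}" by (intro block_user) simp
    with d have "d (p div L + 1) \<in> {1..N}" unfolding demands_def by (rule PiE_mem)
    with p assms(2) show "?h p \<in> {1..N} \<times> {..<F}" by simp
  qed
  ultimately show ?thesis
    using True by (simp add: transmitted_def card_Diff_subset diff_mult_distrib2)
next
  case False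
  then have "card (d ` {1..N}) \<noteq> N"
    using eq_card_imp_inj_on[of "{1..N}" d] by auto
  moreover have "card (d ` {1..N}) \<le> N"
    using card_image_le[of "{1..N}" d] by simp
  ultimately have "card (d ` {1..N}) \<le> N - 1" by linarith
  then have "card (d ` {1..N}) * F \<le> (N - 1) * F" by (rule mult_le_mono1)
  also have "\<dots> = N * F - F" by (simp add: diff_mult_distrib)
  also have "\<dots> \<le> N * (F - L)" using assms(2) by (simp add: diff_mult_distrib2)
  finally show ?thesis using False by (simp add: transmitted_def card_cartesian_product)
qed

text \<open>Odd parity is the exclusive or over all files. Users count from 1 and positions from 0,
  so block \<open>k\<close> starts at \<open>(k - 1) * L\<close>.\<close>

definition cached_parities :: "nat \<Rightarrow> nat \<Rightarrow> nat \<Rightarrow> (nat \<Rightarrow> bits) \<Rightarrow> nat set" where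
  "cached_parities N L k W = {i. i < L \<and> odd (card {n \<in> {1..N}. W n ! ((k - 1) * L + i)})}"

lemma file_determined:
  assumes d: "d \<in> demands N N" and k: "k \<in> {1..N}"
    and len: "length (W (d k)) = F" "length (W' (d k)) = F"
    and Z: "cached_parities N L k W = cached_parities N L k W'"
    and X: "{(n, p) \<in> transmitted N F L d. W n ! p} = {(n, p) \<in> transmitted N F L d. W' n ! p}"
  shows "W (d k) = W' (d k)"
proof (rule nth_equalityI)
  show "length (W (d k)) = length (W' (d k))" using len by simp
next
  fix p assume "p < length (W (d k))"
  then have p: "p < F" using len by simp
  have sent: "W n ! q = W' n ! q" if "(n, q) \<in> transmitted N F L d" for n q
    using X that by (auto simp: set_eq_iff)
  have dk: "d k \<in> {1..N}" using d k unfolding demands_def by (rule PiE_mem)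
  show "W (d k) ! p = W' (d k) ! p"
  proof (cases "(d k, p) \<in> transmitted N F L d")
    case True
    then show ?thesis by (rule sent)
  next
    case False
    \<comment> \<open>With coinciding demands the whole file \<open>d k\<close> is transmitted, so a
      missing bit forces distinct demands.\<close>
    then have inj: "inj_on d {1..N}"
      using k p by (auto simp: transmitted_def split: if_splits)
    with False p dk have "p < N * L" and eq: "d k = d (p div L + 1)"
      by (auto simp: transmitted_def)
    \<comment> \<open>Distinct demands turn equality of the requested files into equality of the
      users: \<open>p\<close> lies in block \<open>k\<close>.\<close>
    then have k_eq: "k = p div L + 1"
      using inj k block_user[of p N L] unfolding inj_on_def by blast
    \<comment> \<open>\<open>p mod L\<close> is the offset of \<open>p\<close> in block
      \<open>k\<close>, hence the index of the cached parity to use.\<close>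
    have "0 < L" using \<open>p < N * L\<close> by (cases L) auto
    moreover have "(k - 1) * L + p mod L = p" by (simp add: k_eq)
    ultimately have "odd (card {n \<in> {1..N}. W n ! p}) = odd (card {n \<in> {1..N}. W' n ! p})"
      using Z by (auto simp: cached_parities_def set_eq_iff dest!: spec[of _ "p mod L"])
    \<comment> \<open>Position \<open>p\<close> is withheld from one file only, that of user
      \<open>p div L + 1\<close>, which is \<open>d k\<close>.\<close>
    moreover have "W n ! p = W' n ! p" if "n \<in> {1..N} - {d k}" for n
      using that p inj eq by (intro sent) (auto simp: transmitted_def)
    ultimately show ?thesis
      using eq_if_parity_eq[OF _ dk, of "\<lambda>n. W n ! p" "\<lambda>n. W' n ! p"] by simp
  qed
qed

lemma coded_scheme:
  assumes "N \<ge> 1" and "N * L \<le> F"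
  shows "\<exists>S. (\<forall>k. num_values N F (placement S k) \<le> 2 ^ L) \<and>
             (\<forall>d\<in>demands N N. num_values N F (delivery S d) \<le> 2 ^ (N * (F - L))) \<and>
             error_probability N N F S = 0"
proof -
  have "\<exists>S. (\<forall>k. num_values N F (placement S k) \<le> 2 ^ card {..<L}) \<and>
            (\<forall>d. num_values N F (delivery S d) \<le> 2 ^ card (transmitted N F L d)) \<and>
            error_probability N N F S = 0"
  proof (rule zero_error_scheme[OF assms(1) assms(1)])
    fix d k W W'
    assume *: "d \<in> demands N N" "k \<in> {1..N}"
      "W \<in> set_pmf (files_pmf N F)" "W' \<in> set_pmf (files_pmf N F)"
      "cached_parities N L k W = cached_parities N L k W'"
      "{(n, p) \<in> transmitted N F L d. W n ! p} = {(n, p) \<in> transmitted N F L d. W' n ! p}"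
    then have "d k \<in> {1..N}" unfolding demands_def by (auto dest: PiE_mem)
    with * show "W (d k) = W' (d k)"
      by (intro file_determined[of d N k W F W' L]) (auto intro: set_pmf_files_pmf)
  qed (auto simp: finite_transmitted cached_parities_def)
  then obtain S where S: "\<And>k. num_values N F (placement S k) \<le> 2 ^ L"
    "\<And>d. num_values N F (delivery S d) \<le> 2 ^ card (transmitted N F L d)"
    "error_probability N N F S = 0"
    by auto
  have "num_values N F (delivery S d) \<le> 2 ^ (N * (F - L))" if "d \<in> demands N N" for d
    using S(2)[of d] power_increasing[OF card_transmitted[OF that assms(2)], of "2 :: nat"]
    by linarith
  with S show ?thesis by blast
qed

section \<open>Asymptotic rate and value of the cut-set bound\<close>

lemma achievable_coded:
  assumes "N \<ge> 1" and "0 \<le> M" and "M \<le> 1 / real N"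
  shows "achievable N N M (real N * (1 - M))"
proof -
  have NM: "real N * M \<le> 1" using assms by (simp add: field_simps)
  have "M \<le> 1" using assms(1,3) by (rule_tac order_trans[of _ "1 / real N"]) auto
  \<comment> \<open>Rounding \<open>M * F\<close> down shortens each of the \<open>N\<close> blocks
    by less than one bit and so costs fewer than \<open>N\<close> further transmitted bits. The
    threshold on \<open>F\<close> makes this loss at most \<open>\<epsilon> * F\<close>.\<close>
  have "\<exists>S. (\<forall>k\<in>{1..N}. real (num_values N F (placement S k)) \<le> 2 powr ((M + \<epsilon>) * real F)) \<and>
            (\<forall>d\<in>demands N N. real (num_values N F (delivery S d))
                \<le> 2 powr ((real N * (1 - M) + \<epsilon>) * real F)) \<and>
            error_probability N N F S < \<epsilon>"
    if \<epsilon>: "\<epsilon> > 0" and "F \<ge> nat \<lceil>real N / \<epsilon>\<rceil>" for \<epsilon> :: real and F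
  proof -
    define L where "L = nat \<lfloor>M * real F\<rfloor>"
    have L: "real L \<le> M * real F" "M * real F < real L + 1"
      using assms(2) by (simp_all add: L_def)
    have "real N * real L \<le> real N * (M * real F)" using L(1) by (intro mult_left_mono) auto
    also have "\<dots> \<le> real F" using mult_right_mono[OF NM, of "real F"] by (simp add: mult.assoc)
    finally have NL: "N * L \<le> F" by (simp flip: of_nat_mult)
    then have "L \<le> F" using assms(1) by (cases N) auto
    have "real N / \<epsilon> \<le> real F" using that(2) by linarith
    then have "real N \<le> \<epsilon> * real F" using \<epsilon> by (simp add: field_simps)
    moreover have "real N * (real F - real L) \<le> real N * (real F - M * real F + 1)"
      using L(2) by (intro mult_left_mono) auto
    ultimately have rate: "real (N * (F - L)) \<le> (real N * (1 - M) + \<epsilon>) * real F"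
      using \<open>L \<le> F\<close> by (simp add: of_nat_diff algebra_simps)
    have memory: "real L \<le> (M + \<epsilon>) * real F"
      using L(1) \<epsilon> by (simp add: distrib_right add_increasing2)
    have bound: "real n \<le> 2 powr b" if "n \<le> 2 ^ m" "real m \<le> b" for n m :: nat and b
    proof -
      have "real n \<le> 2 powr real m"
        using that(1) by (simp add: powr_realpow flip: of_nat_le_iff)
      also have "\<dots> \<le> 2 powr b" using that(2) by simp
      finally show ?thesis .
    qed
    from coded_scheme[OF assms(1) NL] show ?thesis
      using bound[OF _ memory] bound[OF _ rate] \<epsilon> by metis
  qed
  then have "\<forall>\<epsilon>>0. \<forall>\<^sub>F F in sequentially. \<exists>S.
      (\<forall>k\<in>{1..N}. real (num_values N F (placement S k)) \<le> 2 powr ((M + \<epsilon>) * real F)) \<and>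
      (\<forall>d\<in>demands N N. real (num_values N F (delivery S d))
          \<le> 2 powr ((real N * (1 - M) + \<epsilon>) * real F)) \<and>
      error_probability N N F S < \<epsilon>"
    unfolding eventually_sequentially by blast
  with assms(2) \<open>M \<le> 1\<close> show ?thesis by (simp add: achievable_def)
qed

text \<open>The maximum is attained at \<open>s = N\<close>, where the floor is 1. For smaller
  \<open>s\<close> the subtracted term is nonnegative, so the value is at most \<open>N - 1\<close>,
  and \<open>N * M \<le> 1\<close> finishes.\<close>

lemma cut_set_bound_small_cache:
  assumes "N \<ge> 1" and "0 \<le> M" and "M \<le> 1 / real N"
  shows "cut_set_bound N N M = real N * (1 - M)"
  unfolding cut_set_bound_def
proof (rule Max_eqI)
  have NM: "real N * M \<le> 1" using assms by (simp add: field_simps)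
  fix y
  assume "y \<in> (\<lambda>s. real s - real s / real_of_int \<lfloor>real N / real s\<rfloor> * M) ` {1..min N N}"
  then obtain s where s: "s \<in> {1..N}"
    and y: "y = real s - real s / real_of_int \<lfloor>real N / real s\<rfloor> * M" by auto
  show "y \<le> real N * (1 - M)"
  proof (cases "s = N")
    case True
    then show ?thesis using y assms by (simp add: algebra_simps)
  next
    case False
    have "0 \<le> real s / real_of_int \<lfloor>real N / real s\<rfloor> * M"
      using assms(2) by (intro mult_nonneg_nonneg divide_nonneg_nonneg) auto
    with y have "y \<le> real s" by simp
    also have "\<dots> \<le> real N - 1" using s False by auto
    also have "\<dots> \<le> real N * (1 - M)" using NM by (simp add: algebra_simps)
    finally show ?thesis .
  qed
next
  show "real N * (1 - M) \<in>
      (\<lambda>s. real s - real s / real_of_int \<lfloor>real N / real s\<rfloor> * M) ` {1..min N N}"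
    using assms(1) by (intro image_eqI[of _ _ N]) (auto simp: algebra_simps)
qed simp

theorem theorem3:
  fixes N K :: nat and M :: real
  assumes "N \<ge> 1" and "K = N" and "0 \<le> M" and "M \<le> 1 / real N"
  shows "achievable N K M (real N * (1 - M)) \<and>
         real N * (1 - M) = cut_set_bound N K M"
  using assms by (simp add: achievable_coded cut_set_bound_small_cache)

end
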